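(* Every sectionally complemented modular lattice with a Banaschewski trace embeds, as a neutral ideal and within the same quasivariety, into some complemented modular lattice. That is, if $L$ is a sectionally complemented modular lattice that has a Banaschewski trace, then there exist a complemented modular lattice $\tilde{L}$ belonging to every quasivariety of lattices that contains $L$, and a lattice embedding $\varepsilon\colon L\to\tilde{L}$ whose range is a neutral ideal of $\tilde{L}$.
   Context: In a lattice with zero, $a\oplus b=c$ means $a\wedge b=0$ and $a\vee b=c$. A lattice $L$ with zero is sectionally complemented if for all $a\leq b$ in $L$ there exists $x\in L$ with $b=a\oplus x$. A lattice is complemented if it has $0$ and $1$ and every element has a complement. A Banaschewski trace on a lattice $L$ with zero is a family $(a_i^j\mid i\leq j\text{ in }\Lambda)$ of elements of $L$, where $\Lambda$ is an upward directed partially ordered set with least element $0$, such that (i) $a_i^k=a_i^j\oplus a_j^k$ for all $i\leq j\leq k$ in $\Lambda$; (ii) $\{a_0^i\mid i\in\Lambda\}$ is cofinal in $L$ (every element of $L$ is below some $a_0^i$). An ideal of a lattice is a nonempty, upward directed, lower subset. An ideal $I$ of a lattice $M$ is neutral if $\{I,X,Y\}$ generates a distributive sublattice of the ideal lattice $\operatorname{Id}M$ for all ideals $X,Y$ of $M$. A quasivariety of lattices is a class of lattices defined by a set of quasi-identities (universally quantified Horn implications between equations in the language $(\vee,\wedge)$). *)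

theory Defs
  imports "HOL-Algebra.Lattice"
begin

locale modular_lattice = lattice +
  assumes modular_law:
    "\<lbrakk>x \<in> carrier L; y \<in> carrier L; z \<in> carrier L; z \<sqsubseteq> x\<rbrakk>
      \<Longrightarrow> x \<sqinter> (y \<squnion> z) = (x \<sqinter> y) \<squnion> z"

locale distributive_lattice = lattice +
  assumes distributive_law:
    "\<lbrakk>x \<in> carrier L; y \<in> carrier L; z \<in> carrier L\<rbrakk>
      \<Longrightarrow> x \<sqinter> (y \<squnion> z) = (x \<sqinter> y) \<squnion> (x \<sqinter> z)"

locale lattice_with_zero = lattice + weak_partial_order_bottom

text \<open>\<open>oplus_eq L a b c\<close> renders \<open>a \<oplus> b = c\<close>; the operation \<open>\<oplus>\<close> is partial.\<close>

definition oplus_eq :: "('a, 'b) gorder_scheme \<Rightarrow> 'a \<Rightarrow> 'a \<Rightarrow> 'a \<Rightarrow> bool" where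
  "oplus_eq L a b c \<longleftrightarrow> a \<sqinter>\<^bsub>L\<^esub> b = \<bottom>\<^bsub>L\<^esub> \<and> a \<squnion>\<^bsub>L\<^esub> b = c"

locale sectionally_complemented_lattice = lattice_with_zero +
  assumes section_complement_exists:
    "\<lbrakk>a \<in> carrier L; b \<in> carrier L; a \<sqsubseteq> b\<rbrakk> \<Longrightarrow> \<exists>x\<in>carrier L. oplus_eq L a x b"

locale complemented_lattice = bounded_lattice +
  assumes complement_exists:
    "x \<in> carrier L \<Longrightarrow> \<exists>y\<in>carrier L. x \<sqinter> y = \<bottom> \<and> x \<squnion> y = \<top>"

definition upward_directed :: "('a, 'b) gorder_scheme \<Rightarrow> 'a set \<Rightarrow> bool" where
  "upward_directed P S \<longleftrightarrow> (\<forall>x\<in>S. \<forall>y\<in>S. \<exists>z\<in>S. x \<sqsubseteq>\<^bsub>P\<^esub> z \<and> y \<sqsubseteq>\<^bsub>P\<^esub> z)"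

text \<open>The element \<open>a\<^sub>i\<^sup>j\<close> is written \<open>a i j\<close>. Only its values for
  \<open>i \<sqsubseteq> j\<close> in the index set are constrained; the index \<open>0\<close> is \<open>\<bottom>\<^bsub>\<Lambda>\<^esub>\<close>.\<close>

definition banaschewski_trace ::
  "('a, 'b) gorder_scheme \<Rightarrow> ('i, 'c) gorder_scheme \<Rightarrow> ('i \<Rightarrow> 'i \<Rightarrow> 'a) \<Rightarrow> bool" where
  "banaschewski_trace L \<Lambda> a \<longleftrightarrow>
     lattice_with_zero L \<and>
     partial_order \<Lambda> \<and> weak_partial_order_bottom \<Lambda> \<and> upward_directed \<Lambda> (carrier \<Lambda>) \<and>
     (\<forall>i\<in>carrier \<Lambda>. \<forall>j\<in>carrier \<Lambda>. i \<sqsubseteq>\<^bsub>\<Lambda>\<^esub> j \<longrightarrow> a i j \<in> carrier L) \<and>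
     (\<forall>i\<in>carrier \<Lambda>. \<forall>j\<in>carrier \<Lambda>. \<forall>k\<in>carrier \<Lambda>.
        i \<sqsubseteq>\<^bsub>\<Lambda>\<^esub> j \<and> j \<sqsubseteq>\<^bsub>\<Lambda>\<^esub> k \<longrightarrow> oplus_eq L (a i j) (a j k) (a i k)) \<and>
     (\<forall>x\<in>carrier L. \<exists>i\<in>carrier \<Lambda>. x \<sqsubseteq>\<^bsub>L\<^esub> a \<bottom>\<^bsub>\<Lambda>\<^esub> i)"

definition lattice_ideal :: "('a, 'b) gorder_scheme \<Rightarrow> 'a set \<Rightarrow> bool" where
  "lattice_ideal M I \<longleftrightarrow>
     I \<subseteq> carrier M \<and> I \<noteq> {} \<and> upward_directed M I \<and>
     (\<forall>x\<in>I. \<forall>y\<in>carrier M. y \<sqsubseteq>\<^bsub>M\<^esub> x \<longrightarrow> y \<in> I)"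

definition ideal_lattice :: "('a, 'b) gorder_scheme \<Rightarrow> 'a set gorder" where
  "ideal_lattice M = \<lparr>carrier = {I. lattice_ideal M I}, eq = (=), le = (\<subseteq>)\<rparr>"

definition sublattice :: "('a, 'b) gorder_scheme \<Rightarrow> 'a set \<Rightarrow> bool" where
  "sublattice M S \<longleftrightarrow>
     S \<subseteq> carrier M \<and> (\<forall>x\<in>S. \<forall>y\<in>S. x \<squnion>\<^bsub>M\<^esub> y \<in> S \<and> x \<sqinter>\<^bsub>M\<^esub> y \<in> S)"

definition generated_sublattice :: "('a, 'b) gorder_scheme \<Rightarrow> 'a set \<Rightarrow> 'a set" where
  "generated_sublattice M A = \<Inter>{S. sublattice M S \<and> A \<subseteq> S}"

definition neutral_ideal :: "('a, 'b) gorder_scheme \<Rightarrow> 'a set \<Rightarrow> bool" where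
  "neutral_ideal M I \<longleftrightarrow>
     lattice_ideal M I \<and>
     (\<forall>X Y. lattice_ideal M X \<and> lattice_ideal M Y \<longrightarrow>
        distributive_lattice
          ((ideal_lattice M)\<lparr>carrier := generated_sublattice (ideal_lattice M) {I, X, Y}\<rparr>))"

datatype lattice_term =
    LVar nat
  | LJoin lattice_term lattice_term
  | LMeet lattice_term lattice_term

primrec eval_term :: "('a, 'b) gorder_scheme \<Rightarrow> (nat \<Rightarrow> 'a) \<Rightarrow> lattice_term \<Rightarrow> 'a" where
  "eval_term M v (LVar n) = v n"
| "eval_term M v (LJoin s t) = eval_term M v s \<squnion>\<^bsub>M\<^esub> eval_term M v t"
| "eval_term M v (LMeet s t) = eval_term M v s \<sqinter>\<^bsub>M\<^esub> eval_term M v t"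

text \<open>\<open>Horn ps (s, t)\<close> is the universal closure of the implication from the conjunction
  of the equations in the (possibly empty) finite list \<open>ps\<close> to \<open>s = t\<close>.\<close>

datatype quasi_identity =
  Horn "(lattice_term \<times> lattice_term) list" "lattice_term \<times> lattice_term"

definition holds_eq ::
  "('a, 'b) gorder_scheme \<Rightarrow> (nat \<Rightarrow> 'a) \<Rightarrow> lattice_term \<times> lattice_term \<Rightarrow> bool" where
  "holds_eq M v e \<longleftrightarrow> eval_term M v (fst e) = eval_term M v (snd e)"

primrec satisfies :: "('a, 'b) gorder_scheme \<Rightarrow> quasi_identity \<Rightarrow> bool" where
  "satisfies M (Horn ps e) \<longleftrightarrow>
     (\<forall>v. range v \<subseteq> carrier M \<longrightarrow> (\<forall>p\<in>set ps. holds_eq M v p) \<longrightarrow> holds_eq M v e)"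

text \<open>The quasivariety defined by \<open>\<Sigma>\<close>. It is a class of lattices on arbitrary carrier types,
  so \<open>\<Sigma>\<close> represents it uniformly and the constant is polymorphic in the type of the lattices.\<close>

definition quasivariety :: "quasi_identity set \<Rightarrow> ('a, 'b) gorder_scheme set" where
  "quasivariety \<Sigma> = {M. lattice M \<and> (\<forall>q\<in>\<Sigma>. satisfies M q)}"

definition lattice_embedding ::
  "('a, 'b) gorder_scheme \<Rightarrow> ('c, 'd) gorder_scheme \<Rightarrow> ('a \<Rightarrow> 'c) \<Rightarrow> bool" where
  "lattice_embedding L M f \<longleftrightarrow>
     f ` carrier L \<subseteq> carrier M \<and> inj_on f (carrier L) \<and> join_pres L M f \<and> meet_pres L M f"

end

theory Submission
  imports Defs
begin

text \<open>Let \<open>L\<close> be a sectionally complemented modular lattice with trace \<open>a\<close>. If \<open>L\<close> had a unit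
  it would be complemented already; in general a complement of \<open>x \<sqsubseteq> a 0 i\<close> should be
  \<open>y \<squnion> e\<close>, where \<open>y\<close> is a complement of \<open>x\<close> in the section below \<open>a 0 i\<close> and \<open>e\<close> is the
  missing piece between \<open>a 0 i\<close> and the unit. The trace supplies approximations \<open>a i j\<close> of
  that piece, one for each \<open>j \<ge> i\<close>, and their coherence \<open>a i k = a i j \<oplus> a j k\<close> makes the
  functions \<open>j \<mapsto> y \<squnion> a i j\<close> behave like single elements.

  So one works in the reduced power of \<open>L\<close> modulo the filter generated by the tails of the
  index set, and takes in it the germs of the constants \<open>x\<close> and of the functions
  \<open>j \<mapsto> x \<squnion> a i j\<close>. Any finitely many of these germs can be written over one index \<open>k\<close>, with
  all the parameters \<open>x\<close> below \<open>a 0 k\<close> (\<open>germ_normal_form\<close>). As \<open>a 0 k \<sqinter> a k j = \<bottom>\<close>, modularity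
  then shows that joins and meets only act on the parameters, and that a meet is shifted only if
  both arguments are (\<open>shift_germ_ops\<close>). Hence these germs form a sublattice, over the index
  \<open>k\<close> a homomorphic image of the section below \<open>a 0 k\<close> times a two-element chain. It is complemented by the
  recipe above (\<open>germ_complement\<close>), and since a Horn implication with finitely many premises
  passes to reduced powers and to sublattices, it satisfies every quasi-identity of \<open>L\<close>
  (\<open>satisfies_germs\<close>).

  The constants form an ideal \<open>I\<close>. It is neutral because an ideal \<open>Z\<close> of the new lattice is
  determined by \<open>Z \<inter> I\<close> and by whether \<open>Z \<subseteq> I\<close>, and both depend on \<open>Z\<close> through
  lattice homomorphisms (\<open>neutral_idealI\<close>). A distributive identity among \<open>I\<close>, \<open>X\<close>, \<open>Y\<close> thereby
  reduces to one among \<open>I\<close>, \<open>X \<inter> I\<close>, \<open>Y \<inter> I\<close>, which holds because a top element and two further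
  elements always generate a distributive lattice.\<close>

section \<open>Lattices presented by operations\<close>

text \<open>Join and meet are choices of suprema and infima, so they cannot be prescribed when an order
  is constructed. Exhibiting explicit operations here yields the lattice together with the
  identification of its join and meet.\<close>

locale lattice_operations =
  fixes N :: "('a, 'b) gorder_scheme" (structure)
    and J :: "'a \<Rightarrow> 'a \<Rightarrow> 'a" and K :: "'a \<Rightarrow> 'a \<Rightarrow> 'a"
  assumes eq_equality: "eq N = (=)"
    and order_refl: "x \<in> carrier N \<Longrightarrow> x \<sqsubseteq> x"
    and order_antisym: "\<lbrakk>x \<sqsubseteq> y; y \<sqsubseteq> x; x \<in> carrier N; y \<in> carrier N\<rbrakk> \<Longrightarrow> x = y"
    and order_trans: "\<lbrakk>x \<sqsubseteq> y; y \<sqsubseteq> z; x \<in> carrier N; y \<in> carrier N; z \<in> carrier N\<rbrakk> \<Longrightarrow> x \<sqsubseteq> z"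
    and J_closed: "\<lbrakk>x \<in> carrier N; y \<in> carrier N\<rbrakk> \<Longrightarrow> J x y \<in> carrier N"
    and J_left: "\<lbrakk>x \<in> carrier N; y \<in> carrier N\<rbrakk> \<Longrightarrow> x \<sqsubseteq> J x y"
    and J_right: "\<lbrakk>x \<in> carrier N; y \<in> carrier N\<rbrakk> \<Longrightarrow> y \<sqsubseteq> J x y"
    and J_least: "\<lbrakk>x \<sqsubseteq> z; y \<sqsubseteq> z; x \<in> carrier N; y \<in> carrier N; z \<in> carrier N\<rbrakk> \<Longrightarrow> J x y \<sqsubseteq> z"
    and K_closed: "\<lbrakk>x \<in> carrier N; y \<in> carrier N\<rbrakk> \<Longrightarrow> K x y \<in> carrier N"
    and K_left: "\<lbrakk>x \<in> carrier N; y \<in> carrier N\<rbrakk> \<Longrightarrow> K x y \<sqsubseteq> x"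
    and K_right: "\<lbrakk>x \<in> carrier N; y \<in> carrier N\<rbrakk> \<Longrightarrow> K x y \<sqsubseteq> y"
    and K_greatest: "\<lbrakk>z \<sqsubseteq> x; z \<sqsubseteq> y; x \<in> carrier N; y \<in> carrier N; z \<in> carrier N\<rbrakk> \<Longrightarrow> z \<sqsubseteq> K x y"
begin

lemma J_is_lub: "\<lbrakk>x \<in> carrier N; y \<in> carrier N\<rbrakk> \<Longrightarrow> least N (J x y) (Upper N {x, y})"
  using J_left J_right J_least J_closed by (auto simp: least_def Upper_def)

lemma K_is_glb: "\<lbrakk>x \<in> carrier N; y \<in> carrier N\<rbrakk> \<Longrightarrow> greatest N (K x y) (Lower N {x, y})"
  using K_left K_right K_greatest K_closed by (auto simp: greatest_def Lower_def)

lemma is_lattice: "lattice N"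
proof unfold_locales
  show "x \<sqsubseteq> z" if "x \<sqsubseteq> y" "y \<sqsubseteq> z" "x \<in> carrier N" "y \<in> carrier N" "z \<in> carrier N" for x y z
    using order_trans that by blast
  show "\<exists>s. least N s (Upper N {x, y})" "\<exists>s. greatest N s (Lower N {x, y})"
    if "x \<in> carrier N" "y \<in> carrier N" for x y
    using J_is_lub[OF that] K_is_glb[OF that] by blast+
qed (simp_all add: eq_equality order_refl order_antisym)

lemma join_eq_J: "\<lbrakk>x \<in> carrier N; y \<in> carrier N\<rbrakk> \<Longrightarrow> x \<squnion> y = J x y"
proof -
  interpret lattice N by (rule is_lattice)
  show "\<lbrakk>x \<in> carrier N; y \<in> carrier N\<rbrakk> \<Longrightarrow> x \<squnion> y = J x y"
    by (intro order_antisym join_le J_least join_left join_right J_left J_right J_closed join_closed)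
qed

lemma meet_eq_K: "\<lbrakk>x \<in> carrier N; y \<in> carrier N\<rbrakk> \<Longrightarrow> x \<sqinter> y = K x y"
proof -
  interpret lattice N by (rule is_lattice)
  show "\<lbrakk>x \<in> carrier N; y \<in> carrier N\<rbrakk> \<Longrightarrow> x \<sqinter> y = K x y"
    by (intro order_antisym meet_le K_greatest meet_left meet_right K_left K_right K_closed meet_closed)
qed

end

text \<open>Replacing the carrier changes the meaning of join and meet, since these quantify over the
  carrier; on a sublattice the new operations agree with the old ones.\<close>

lemma sublattice_operations:
  assumes "lattice N" and S: "sublattice N S"
  shows "lattice_operations (N\<lparr>carrier := S\<rparr>) (join N) (meet N)"
proof -
  interpret lattice N by fact
  have sub: "x \<in> carrier N" if "x \<in> S" for x
    using S that by (auto simp: sublattice_def)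
  show ?thesis
  proof
    show "x \<sqsubseteq>\<^bsub>N\<lparr>carrier := S\<rparr>\<^esub> z"
      if "x \<sqsubseteq>\<^bsub>N\<lparr>carrier := S\<rparr>\<^esub> y" "y \<sqsubseteq>\<^bsub>N\<lparr>carrier := S\<rparr>\<^esub> z"
        "x \<in> carrier (N\<lparr>carrier := S\<rparr>)" "y \<in> carrier (N\<lparr>carrier := S\<rparr>)" "z \<in> carrier (N\<lparr>carrier := S\<rparr>)"
      for x y z
      using le_trans[of x y z] that sub by simp
  qed (use S sub in \<open>auto simp: sublattice_def eq_is_equal join_left join_right meet_left meet_right
         intro: join_le meet_le\<close>)
qed

section \<open>Ideals and neutrality\<close>

definition ideal_join :: "('a, 'b) gorder_scheme \<Rightarrow> 'a set \<Rightarrow> 'a set \<Rightarrow> 'a set" where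
  "ideal_join M X Y = {f \<in> carrier M. \<exists>x\<in>X. \<exists>y\<in>Y. f \<sqsubseteq>\<^bsub>M\<^esub> x \<squnion>\<^bsub>M\<^esub> y}"

context lattice
begin

lemma ideal_carrier: "lattice_ideal L X \<Longrightarrow> x \<in> X \<Longrightarrow> x \<in> carrier L"
  by (auto simp: lattice_ideal_def)

lemma ideal_down: "\<lbrakk>lattice_ideal L X; x \<in> X; y \<in> carrier L; y \<sqsubseteq> x\<rbrakk> \<Longrightarrow> y \<in> X"
  by (auto simp: lattice_ideal_def)

lemma ideal_join_mem:
  assumes X: "lattice_ideal L X" and "x \<in> X" "y \<in> X"
  shows "x \<squnion> y \<in> X"
proof -
  obtain z where "z \<in> X" "x \<sqsubseteq> z" "y \<sqsubseteq> z"
    using assms unfolding lattice_ideal_def upward_directed_def by meson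
  with assms show ?thesis
    by (intro ideal_down[OF X \<open>z \<in> X\<close>] join_le join_closed) (auto intro: ideal_carrier)
qed

lemma ideal_meet_mem:
  assumes "lattice_ideal L X" "lattice_ideal L Y" "x \<in> X" "y \<in> Y"
  shows "x \<sqinter> y \<in> X \<inter> Y"
  using assms by (meson IntI ideal_carrier ideal_down meet_closed meet_left meet_right)

lemma lattice_idealI:
  assumes "X \<subseteq> carrier L" "X \<noteq> {}"
    and "\<And>x y. x \<in> X \<Longrightarrow> y \<in> X \<Longrightarrow> x \<squnion> y \<in> X"
    and "\<And>x y. x \<in> X \<Longrightarrow> y \<in> carrier L \<Longrightarrow> y \<sqsubseteq> x \<Longrightarrow> y \<in> X"
  shows "lattice_ideal L X"
  unfolding lattice_ideal_def upward_directed_def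
  using assms by (meson join_left join_right subsetD)

lemma ideal_inter:
  assumes "lattice_ideal L X" "lattice_ideal L Y"
  shows "lattice_ideal L (X \<inter> Y)"
proof (rule lattice_idealI)
  show "X \<inter> Y \<noteq> {}"
    using assms ideal_meet_mem[OF assms] unfolding lattice_ideal_def by blast
qed (use assms in \<open>auto intro: ideal_carrier ideal_join_mem ideal_down\<close>)

lemma ideal_joinI:
  "\<lbrakk>f \<in> carrier L; x \<in> X; y \<in> Y; f \<sqsubseteq> x \<squnion> y\<rbrakk> \<Longrightarrow> f \<in> ideal_join L X Y"
  by (auto simp: ideal_join_def)

lemma ideal_join_upper:
  assumes "lattice_ideal L X" "lattice_ideal L Y"
  shows "X \<subseteq> ideal_join L X Y" "Y \<subseteq> ideal_join L X Y"
proof -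
  obtain x y where xy: "x \<in> X" "y \<in> Y"
    using assms by (auto simp: lattice_ideal_def)
  have c: "z \<in> carrier L" if "z \<in> X \<or> z \<in> Y" for z
    using assms that ideal_carrier by blast
  show "X \<subseteq> ideal_join L X Y"
  proof
    fix z assume "z \<in> X"
    then show "z \<in> ideal_join L X Y"
      using ideal_joinI[of z z X y Y] xy c by (simp add: join_left)
  qed
  show "Y \<subseteq> ideal_join L X Y"
  proof
    fix z assume "z \<in> Y"
    then show "z \<in> ideal_join L X Y"
      using ideal_joinI[of z x X z Y] xy c by (simp add: join_right)
  qed
qed

lemma ideal_join_least:
  assumes Z: "lattice_ideal L Z" and "X \<subseteq> Z" "Y \<subseteq> Z"
  shows "ideal_join L X Y \<subseteq> Z"
proof
  fix f assume "f \<in> ideal_join L X Y"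
  then obtain x y where "f \<in> carrier L" "x \<in> X" "y \<in> Y" "f \<sqsubseteq> x \<squnion> y"
    by (auto simp: ideal_join_def)
  then show "f \<in> Z"
    using assms(2,3) ideal_down[OF Z ideal_join_mem[OF Z, of x y], of f] by auto
qed

lemma ideal_join_ideal:
  assumes X: "lattice_ideal L X" and Y: "lattice_ideal L Y"
  shows "lattice_ideal L (ideal_join L X Y)"
proof (rule lattice_idealI)
  show "ideal_join L X Y \<noteq> {}"
    using ideal_join_upper[OF X Y] X by (auto simp: lattice_ideal_def)
  show "f \<in> ideal_join L X Y" if g: "g \<in> ideal_join L X Y" and f: "f \<in> carrier L" "f \<sqsubseteq> g" for f g
  proof -
    obtain x y where "x \<in> X" "y \<in> Y" "g \<sqsubseteq> x \<squnion> y" "g \<in> carrier L"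
      using g by (auto simp: ideal_join_def)
    with f X Y show ?thesis
      by (meson ideal_carrier ideal_joinI join_closed le_trans)
  qed
  show "f \<squnion> g \<in> ideal_join L X Y" if f: "f \<in> ideal_join L X Y" and g: "g \<in> ideal_join L X Y" for f g
  proof -
    obtain x y where f': "x \<in> X" "y \<in> Y" "f \<sqsubseteq> x \<squnion> y" "f \<in> carrier L"
      using f by (auto simp: ideal_join_def)
    obtain x' y' where g': "x' \<in> X" "y' \<in> Y" "g \<sqsubseteq> x' \<squnion> y'" "g \<in> carrier L"
      using g by (auto simp: ideal_join_def)
    have c: "x \<in> carrier L" "y \<in> carrier L" "x' \<in> carrier L" "y' \<in> carrier L"
      using X Y f' g' by (auto intro: ideal_carrier)
    have "x \<squnion> y \<sqsubseteq> (x \<squnion> x') \<squnion> (y \<squnion> y')" "x' \<squnion> y' \<sqsubseteq> (x \<squnion> x') \<squnion> (y \<squnion> y')"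
      using c by (auto intro!: join_le join_closed intro: le_trans[OF join_left join_left]
          le_trans[OF join_left join_right] le_trans[OF join_right join_left]
          le_trans[OF join_right join_right])
    then have "f \<squnion> g \<sqsubseteq> (x \<squnion> x') \<squnion> (y \<squnion> y')"
      using c f' g' by (intro join_le) (auto intro: le_trans[of f "x \<squnion> y"] le_trans[of g "x' \<squnion> y'"])
    then show ?thesis
      using X Y f' g' by (intro ideal_joinI[of _ "x \<squnion> x'" _ "y \<squnion> y'"]) (auto intro: ideal_join_mem)
  qed
qed (auto simp: ideal_join_def)

lemma ideal_lattice_operations: "lattice_operations (ideal_lattice L) (ideal_join L) (\<inter>)"
proof
  fix X Y Z
  let ?Id = "ideal_lattice L"
  show "X \<sqsubseteq>\<^bsub>?Id\<^esub> Y \<Longrightarrow> Y \<sqsubseteq>\<^bsub>?Id\<^esub> X \<Longrightarrow> X = Y"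
    "X \<sqsubseteq>\<^bsub>?Id\<^esub> Y \<Longrightarrow> Y \<sqsubseteq>\<^bsub>?Id\<^esub> Z \<Longrightarrow> X \<sqsubseteq>\<^bsub>?Id\<^esub> Z"
    by (auto simp: ideal_lattice_def)
qed (simp_all add: ideal_lattice_def ideal_join_ideal ideal_inter ideal_join_upper ideal_join_least)

lemma ideal_join_absorb:
  assumes "lattice_ideal L X" "lattice_ideal L Y" "X \<subseteq> Y"
  shows "ideal_join L X Y = Y" "ideal_join L Y X = Y"
  using ideal_join_upper[OF assms(1,2)] ideal_join_upper[OF assms(2,1)]
    ideal_join_least[OF assms(2,3) subset_refl] ideal_join_least[OF assms(2) subset_refl assms(3)]
  by blast+

lemma ideal_join_commute: "ideal_join L X Y = ideal_join L Y X"
proof -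
  have "ideal_join L U V \<subseteq> ideal_join L V U" for U V
  proof
    fix f assume "f \<in> ideal_join L U V"
    then obtain u v where "f \<in> carrier L" "u \<in> U" "v \<in> V" "f \<sqsubseteq> u \<squnion> v"
      by (auto simp: ideal_join_def)
    then show "f \<in> ideal_join L V U"
      using ideal_joinI[of f v V u U] by (simp add: join_comm)
  qed
  then show ?thesis by blast
qed

text \<open>In any lattice, a top element \<open>I\<close> and two further elements \<open>A\<close>, \<open>B\<close> generate only
  \<open>I\<close>, \<open>A\<close>, \<open>B\<close>, \<open>A \<inter> B\<close> and \<open>A \<squnion> B\<close>. The only incomparable pair among these is
  \<open>A\<close>, \<open>B\<close>, so the tables of both operations are absorption laws, and distributivity can be
  read off from them.\<close>

lemma distributive_ideals_below:
  assumes I: "lattice_ideal L I" and A: "lattice_ideal L A" and B: "lattice_ideal L B"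
    and below: "A \<subseteq> I" "B \<subseteq> I"
  obtains D where "I \<in> D" "A \<in> D" "B \<in> D"
    and "\<And>U V. \<lbrakk>U \<in> D; V \<in> D\<rbrakk> \<Longrightarrow> ideal_join L U V \<in> D"
    and "\<And>U V. \<lbrakk>U \<in> D; V \<in> D\<rbrakk> \<Longrightarrow> U \<inter> V \<in> D"
    and "\<And>U V W. \<lbrakk>U \<in> D; V \<in> D; W \<in> D\<rbrakk>
      \<Longrightarrow> U \<inter> ideal_join L V W = ideal_join L (U \<inter> V) (U \<inter> W)"
proof -
  let ?J = "ideal_join L"
  define P where "P = A \<inter> B"
  define Q where "Q = ?J A B"
  have P: "lattice_ideal L P" and Q: "lattice_ideal L Q"
    unfolding P_def Q_def using ideal_inter[OF A B] ideal_join_ideal[OF A B] by simp_all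
  have "P \<subseteq> A" "P \<subseteq> B"
    by (auto simp: P_def)
  moreover have "A \<subseteq> Q" "B \<subseteq> Q" "Q \<subseteq> I"
    using ideal_join_upper[OF A B] ideal_join_least[OF I below] by (simp_all add: Q_def)
  ultimately have incl: "P \<subseteq> A" "P \<subseteq> B" "A \<subseteq> Q" "B \<subseteq> Q" "P \<subseteq> Q" "Q \<subseteq> I" "P \<subseteq> I"
    by auto
  have joins: "?J A B = Q" "?J B A = Q"
    using ideal_join_commute[of B A] by (simp_all only: Q_def)
  have meets: "A \<inter> B = P" "B \<inter> A = P"
    unfolding P_def by auto
  note joins = joins ideal_join_absorb[OF _ _ subset_refl] ideal_join_absorb[OF A I below(1)]
    ideal_join_absorb[OF B I below(2)] ideal_join_absorb[OF P A incl(1)]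
    ideal_join_absorb[OF P B incl(2)] ideal_join_absorb[OF A Q incl(3)]
    ideal_join_absorb[OF B Q incl(4)] ideal_join_absorb[OF P Q incl(5)]
    ideal_join_absorb[OF Q I incl(6)] ideal_join_absorb[OF P I incl(7)]
  note meets = meets Int_absorb incl[THEN Int_absorb1] incl[THEN Int_absorb2]
    below[THEN Int_absorb1] below[THEN Int_absorb2]
  note tables = joins meets I A B P Q
  show ?thesis
  proof (rule that[of "{I, A, B, P, Q}"])
    show "?J U V \<in> {I, A, B, P, Q}" "U \<inter> V \<in> {I, A, B, P, Q}"
      if "U \<in> {I, A, B, P, Q}" "V \<in> {I, A, B, P, Q}" for U V
      using that by (elim insertE emptyE; simp only: tables insert_iff simp_thms)+
    show "U \<inter> ?J V W = ?J (U \<inter> V) (U \<inter> W)"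
      if "U \<in> {I, A, B, P, Q}" "V \<in> {I, A, B, P, Q}" "W \<in> {I, A, B, P, Q}" for U V W
      using that by (elim insertE emptyE; simp only: tables)
  qed (rule insertI1 insertI2)+
qed

end

text \<open>A criterion for neutrality. The first condition says that \<open>Z \<mapsto> Z \<inter> I\<close> preserves joins of
  ideals; the second, that \<open>Z \<mapsto> (Z \<subseteq> I)\<close> turns intersections into disjunctions; the third,
  that these two data determine \<open>Z\<close>. Thus the lattice of ideals embeds into the product of the
  ideals below \<open>I\<close> with a two-element chain, and distributivity is checked in both factors.\<close>

lemma (in lattice) neutral_idealI:
  assumes I: "lattice_ideal L I"
    and split: "\<And>x u v. \<lbrakk>x \<in> I; u \<in> carrier L; v \<in> carrier L; x \<sqsubseteq> u \<squnion> v\<rbrakk>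
      \<Longrightarrow> \<exists>y\<in>I. \<exists>z\<in>I. y \<sqsubseteq> u \<and> z \<sqsubseteq> v \<and> x \<sqsubseteq> y \<squnion> z"
    and prime: "\<And>u v. \<lbrakk>u \<in> carrier L; v \<in> carrier L; u \<sqinter> v \<in> I\<rbrakk> \<Longrightarrow> u \<in> I \<or> v \<in> I"
    and cover: "\<And>u w. \<lbrakk>u \<in> carrier L; w \<in> carrier L; w \<notin> I\<rbrakk> \<Longrightarrow> \<exists>y\<in>I. y \<sqsubseteq> u \<and> u \<sqsubseteq> y \<squnion> w"
  shows "neutral_ideal L I"
  unfolding neutral_ideal_def
proof (intro conjI allI impI I)
  fix X Y assume XY: "lattice_ideal L X \<and> lattice_ideal L Y"
  then have X: "lattice_ideal L X" and Y: "lattice_ideal L Y" by auto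
  interpret Id: lattice_operations "ideal_lattice L" "ideal_join L" "(\<inter>)"
    by (rule ideal_lattice_operations)
  let ?J = "ideal_join L"
  have car: "Z \<in> carrier (ideal_lattice L) \<longleftrightarrow> lattice_ideal L Z" for Z
    by (simp add: ideal_lattice_def)
  have trace_join: "?J U V \<inter> I = ?J (U \<inter> I) (V \<inter> I)"
    if U: "lattice_ideal L U" and V: "lattice_ideal L V" for U V
  proof (rule subset_antisym)
    show "?J (U \<inter> I) (V \<inter> I) \<subseteq> ?J U V \<inter> I"
      using ideal_join_least[OF I, of "U \<inter> I" "V \<inter> I"] unfolding ideal_join_def by auto
    show "?J U V \<inter> I \<subseteq> ?J (U \<inter> I) (V \<inter> I)"
    proof
      fix x assume x: "x \<in> ?J U V \<inter> I"
      then obtain u v where uv: "u \<in> U" "v \<in> V" "x \<sqsubseteq> u \<squnion> v" by (auto simp: ideal_join_def)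
      have c: "u \<in> carrier L" "v \<in> carrier L" "x \<in> carrier L"
        using ideal_carrier[OF U] ideal_carrier[OF V] ideal_carrier[OF I] uv x by auto
      then obtain y z where yz: "y \<in> I" "z \<in> I" "y \<sqsubseteq> u" "z \<sqsubseteq> v" "x \<sqsubseteq> y \<squnion> z"
        using split[of x u v] uv x by auto
      moreover have "y \<in> U" "z \<in> V"
        using ideal_down[OF U] ideal_down[OF V] ideal_carrier[OF I] uv yz by auto
      ultimately show "x \<in> ?J (U \<inter> I) (V \<inter> I)"
        using ideal_joinI[of x y "U \<inter> I" z "V \<inter> I"] c by simp
    qed
  qed
  have inter_sub: "U \<inter> V \<subseteq> I \<longleftrightarrow> U \<subseteq> I \<or> V \<subseteq> I"
    if U: "lattice_ideal L U" and V: "lattice_ideal L V" for U V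
  proof
    assume sub: "U \<inter> V \<subseteq> I"
    have "u \<in> I \<or> v \<in> I" if "u \<in> U" "v \<in> V" for u v
      using prime[of u v] ideal_meet_mem[OF U V that] ideal_carrier[OF U that(1)]
        ideal_carrier[OF V that(2)] sub by auto
    then show "U \<subseteq> I \<or> V \<subseteq> I" by auto
  qed auto
  have join_sub: "?J U V \<subseteq> I \<longleftrightarrow> U \<subseteq> I \<and> V \<subseteq> I"
    if U: "lattice_ideal L U" and V: "lattice_ideal L V" for U V
    using ideal_join_upper[OF U V] ideal_join_least[OF I, of U V] by auto
  have trace_sub: "W \<subseteq> Z"
    if W: "lattice_ideal L W" and Z: "lattice_ideal L Z" and eq: "W \<inter> I = Z \<inter> I"
      and sub: "Z \<subseteq> I \<Longrightarrow> W \<subseteq> I" for W Z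
  proof (cases "W \<subseteq> I")
    case True
    then show ?thesis using eq by auto
  next
    case False
    then obtain w where w: "w \<in> Z" "w \<notin> I" using sub by auto
    show ?thesis
    proof
      fix f assume f: "f \<in> W"
      have fc: "f \<in> carrier L" using ideal_carrier[OF W f] .
      then obtain y where y: "y \<in> I" "y \<sqsubseteq> f" "f \<sqsubseteq> y \<squnion> w"
        using cover[of f w] w ideal_carrier[OF Z] by auto
      have "y \<in> W \<inter> I" using f y ideal_down[OF W f] ideal_carrier[OF I] by simp
      then have "y \<in> Z" using eq by simp
      then show "f \<in> Z"
        using ideal_down[OF Z ideal_join_mem[OF Z _ w(1)] fc y(3)] by simp
    qed
  qed
  have XI: "lattice_ideal L (X \<inter> I)" and YI: "lattice_ideal L (Y \<inter> I)"
    using X Y I by (auto intro: ideal_inter)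
  obtain D where D: "I \<in> D" "X \<inter> I \<in> D" "Y \<inter> I \<in> D"
    and D_join: "\<And>U V. \<lbrakk>U \<in> D; V \<in> D\<rbrakk> \<Longrightarrow> ?J U V \<in> D"
    and D_inter: "\<And>U V. \<lbrakk>U \<in> D; V \<in> D\<rbrakk> \<Longrightarrow> U \<inter> V \<in> D"
    and D_distrib: "\<And>U V W. \<lbrakk>U \<in> D; V \<in> D; W \<in> D\<rbrakk> \<Longrightarrow> U \<inter> ?J V W = ?J (U \<inter> V) (U \<inter> W)"
    by (rule distributive_ideals_below[OF I XI YI Int_lower2 Int_lower2]) blast
  \<comment> \<open>The sublattice generated by \<open>I\<close>, \<open>X\<close>, \<open>Y\<close> is not computed; it suffices that it lies in the
    inverse image of \<open>D\<close> under intersection with \<open>I\<close>.\<close>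
  define S where "S = {Z. lattice_ideal L Z \<and> Z \<inter> I \<in> D}"
  let ?G = "generated_sublattice (ideal_lattice L) {I, X, Y}"
  have S: "sublattice (ideal_lattice L) S"
    unfolding sublattice_def
  proof (intro conjI ballI)
    fix U V assume "U \<in> S" "V \<in> S"
    then have U: "lattice_ideal L U" "U \<inter> I \<in> D" and V: "lattice_ideal L V" "V \<inter> I \<in> D"
      by (auto simp: S_def)
    show "U \<squnion>\<^bsub>ideal_lattice L\<^esub> V \<in> S"
      using U V by (simp add: Id.join_eq_J car S_def ideal_join_ideal trace_join D_join)
    have "U \<inter> V \<inter> I = (U \<inter> I) \<inter> (V \<inter> I)" by auto
    then show "U \<sqinter>\<^bsub>ideal_lattice L\<^esub> V \<in> S"
      using U V by (simp only: Id.meet_eq_K car S_def mem_Collect_eq ideal_inter D_inter)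
  qed (auto simp: S_def car)
  have "{I, X, Y} \<subseteq> S"
    using I X Y D by (auto simp: S_def)
  then have GS: "?G \<subseteq> S"
    using S by (auto simp: generated_sublattice_def)
  have G: "sublattice (ideal_lattice L) ?G"
    unfolding sublattice_def
  proof (intro conjI ballI)
    show "?G \<subseteq> carrier (ideal_lattice L)"
      using GS S unfolding sublattice_def by (meson subset_trans)
  qed (simp_all add: generated_sublattice_def sublattice_def)
  interpret G: lattice_operations "(ideal_lattice L)\<lparr>carrier := ?G\<rparr>" "join (ideal_lattice L)" "meet (ideal_lattice L)"
    by (rule sublattice_operations[OF Id.is_lattice G])
  interpret GL: lattice "(ideal_lattice L)\<lparr>carrier := ?G\<rparr>"
    by (rule G.is_lattice)
  show "distributive_lattice ((ideal_lattice L)\<lparr>carrier := ?G\<rparr>)"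
  proof
    let ?N = "(ideal_lattice L)\<lparr>carrier := ?G\<rparr>"
    fix U V W assume c: "U \<in> carrier ?N" "V \<in> carrier ?N" "W \<in> carrier ?N"
    then have id: "lattice_ideal L U" "lattice_ideal L V" "lattice_ideal L W"
      and D: "U \<inter> I \<in> D" "V \<inter> I \<in> D" "W \<inter> I \<in> D"
      using GS by (auto simp: S_def)
    have idJ: "lattice_ideal L (U \<inter> ?J V W)" "lattice_ideal L (?J (U \<inter> V) (U \<inter> W))"
      using id by (auto intro: ideal_inter ideal_join_ideal)
    have "U \<inter> ?J V W \<inter> I = (U \<inter> I) \<inter> (?J V W \<inter> I)" by auto
    also have "\<dots> = ?J ((U \<inter> I) \<inter> (V \<inter> I)) ((U \<inter> I) \<inter> (W \<inter> I))"
      using id D by (simp only: trace_join D_distrib)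
    also have "\<dots> = ?J (U \<inter> V \<inter> I) (U \<inter> W \<inter> I)"
      by (simp add: Int_ac)
    also have "\<dots> = ?J (U \<inter> V) (U \<inter> W) \<inter> I"
      using id by (simp add: trace_join ideal_inter)
    finally have tr: "U \<inter> ?J V W \<inter> I = ?J (U \<inter> V) (U \<inter> W) \<inter> I" .
    have "U \<inter> ?J V W \<subseteq> I \<longleftrightarrow> ?J (U \<inter> V) (U \<inter> W) \<subseteq> I"
      using id by (auto simp: inter_sub join_sub ideal_inter ideal_join_ideal)
    then have "U \<inter> ?J V W = ?J (U \<inter> V) (U \<inter> W)"
      using trace_sub[OF idJ tr] trace_sub[OF idJ(2,1) tr[symmetric]] by auto
    moreover have "U \<sqinter>\<^bsub>?N\<^esub> (V \<squnion>\<^bsub>?N\<^esub> W) = U \<inter> ?J V W"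
      using c id G.J_closed[OF c(2,3)]
      by (simp add: G.join_eq_J G.meet_eq_K Id.join_eq_J Id.meet_eq_K car ideal_join_ideal)
    moreover have "(U \<sqinter>\<^bsub>?N\<^esub> V) \<squnion>\<^bsub>?N\<^esub> (U \<sqinter>\<^bsub>?N\<^esub> W) = ?J (U \<inter> V) (U \<inter> W)"
      using c id G.K_closed[OF c(1,2)] G.K_closed[OF c(1,3)]
      by (simp add: G.join_eq_J G.meet_eq_K Id.join_eq_J Id.meet_eq_K car ideal_inter)
    ultimately show "U \<sqinter>\<^bsub>?N\<^esub> (V \<squnion>\<^bsub>?N\<^esub> W) = (U \<sqinter>\<^bsub>?N\<^esub> V) \<squnion>\<^bsub>?N\<^esub> (U \<sqinter>\<^bsub>?N\<^esub> W)"
      by simp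
  qed
qed

section \<open>Reduced powers\<close>

definition germ :: "'i filter \<Rightarrow> ('i \<Rightarrow> 'a) \<Rightarrow> ('i \<Rightarrow> 'a) set" where
  "germ F f = {g. \<forall>\<^sub>F j in F. g j = f j}"

lemma germ_self: "f \<in> germ F f"
  by (simp add: germ_def)

lemma germ_eq_iff: "germ F f = germ F g \<longleftrightarrow> (\<forall>\<^sub>F j in F. f j = g j)"
proof
  assume "germ F f = germ F g"
  then show "\<forall>\<^sub>F j in F. f j = g j"
    using germ_self[of f F] by (simp add: germ_def)
next
  assume *: "\<forall>\<^sub>F j in F. f j = g j"
  show "germ F f = germ F g"
    unfolding germ_def using * by (auto elim: eventually_elim2)
qed

text \<open>The representatives of an element are exactly the functions that agree with it eventually,
  so the order can be stated on the classes without choosing representatives. With \<open>S\<close> the set of all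
  functions into \<open>L\<close> this is the reduced power of \<open>L\<close> modulo \<open>F\<close>.\<close>

definition germ_order :: "('a, 'b) gorder_scheme \<Rightarrow> 'i filter \<Rightarrow> ('i \<Rightarrow> 'a) set \<Rightarrow> ('i \<Rightarrow> 'a) set gorder" where
  "germ_order L F S = \<lparr>carrier = germ F ` S, eq = (=),
     le = (\<lambda>A B. \<exists>f\<in>A. \<exists>g\<in>B. \<forall>\<^sub>F j in F. f j \<sqsubseteq>\<^bsub>L\<^esub> g j)\<rparr>"

definition germ_lift :: "'i filter \<Rightarrow> ('a \<Rightarrow> 'a \<Rightarrow> 'a) \<Rightarrow> ('i \<Rightarrow> 'a) set \<Rightarrow> ('i \<Rightarrow> 'a) set \<Rightarrow> ('i \<Rightarrow> 'a) set" where
  "germ_lift F b A B = {h. \<exists>f\<in>A. \<exists>g\<in>B. \<forall>\<^sub>F j in F. h j = b (f j) (g j)}"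

lemma germ_lift_germ: "germ_lift F b (germ F f) (germ F g) = germ F (\<lambda>j. b (f j) (g j))"
proof (rule Set.set_eqI)
  fix h
  show "h \<in> germ_lift F b (germ F f) (germ F g) \<longleftrightarrow> h \<in> germ F (\<lambda>j. b (f j) (g j))"
  proof
    assume "h \<in> germ_lift F b (germ F f) (germ F g)"
    then obtain f' g' where "\<forall>\<^sub>F j in F. f' j = f j" "\<forall>\<^sub>F j in F. g' j = g j"
      "\<forall>\<^sub>F j in F. h j = b (f' j) (g' j)"
      by (auto simp: germ_lift_def germ_def)
    then have "\<forall>\<^sub>F j in F. h j = b (f j) (g j)" by eventually_elim simp
    then show "h \<in> germ F (\<lambda>j. b (f j) (g j))" by (simp add: germ_def)
  next
    assume "h \<in> germ F (\<lambda>j. b (f j) (g j))"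
    then show "h \<in> germ_lift F b (germ F f) (germ F g)"
      using germ_self[of f F] germ_self[of g F] unfolding germ_lift_def germ_def by blast
  qed
qed

lemma germ_le_iff:
  "germ F f \<sqsubseteq>\<^bsub>germ_order L F S\<^esub> germ F g \<longleftrightarrow> (\<forall>\<^sub>F j in F. f j \<sqsubseteq>\<^bsub>L\<^esub> g j)"
proof
  assume "germ F f \<sqsubseteq>\<^bsub>germ_order L F S\<^esub> germ F g"
  then obtain f' g' where "\<forall>\<^sub>F j in F. f' j = f j" "\<forall>\<^sub>F j in F. g' j = g j"
    "\<forall>\<^sub>F j in F. f' j \<sqsubseteq>\<^bsub>L\<^esub> g' j"
    by (auto simp: germ_order_def germ_def)
  then show "\<forall>\<^sub>F j in F. f j \<sqsubseteq>\<^bsub>L\<^esub> g j" by eventually_elim simp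
next
  assume "\<forall>\<^sub>F j in F. f j \<sqsubseteq>\<^bsub>L\<^esub> g j"
  then show "germ F f \<sqsubseteq>\<^bsub>germ_order L F S\<^esub> germ F g"
    using germ_self[of f F] germ_self[of g F] by (auto simp: germ_order_def)
qed

text \<open>Closure under the operations is required of the germs and not of the functions: a pointwise
  join of the functions used below agrees with a member of \<open>S\<close> only on a set of the filter.\<close>

locale reduced_power_sublattice = lattice L for L :: "('a, 'b) gorder_scheme" (structure) +
  fixes F :: "'i filter" and S :: "('i \<Rightarrow> 'a) set"
  assumes representative_closed: "f \<in> S \<Longrightarrow> f j \<in> carrier L"
    and join_representable: "\<lbrakk>f \<in> S; g \<in> S\<rbrakk> \<Longrightarrow> germ F (\<lambda>j. f j \<squnion> g j) \<in> germ F ` S"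
    and meet_representable: "\<lbrakk>f \<in> S; g \<in> S\<rbrakk> \<Longrightarrow> germ F (\<lambda>j. f j \<sqinter> g j) \<in> germ F ` S"
begin

abbreviation M :: "('i \<Rightarrow> 'a) set gorder" where
  "M \<equiv> germ_order L F S"

lemma carrier_germs: "carrier M = germ F ` S"
  by (simp add: germ_order_def)

lemma carrier_germsE:
  assumes "A \<in> carrier M"
  obtains f where "f \<in> S" "A = germ F f"
  using assms by (auto simp: carrier_germs)

lemma germs_operations: "lattice_operations M (germ_lift F (join L)) (germ_lift F (meet L))"
proof
  show "eq M = (=)" by (simp add: germ_order_def)
next
  fix A assume "A \<in> carrier M"
  then show "A \<sqsubseteq>\<^bsub>M\<^esub> A" by (auto simp: carrier_germs germ_le_iff representative_closed)
next
  fix A B assume le: "A \<sqsubseteq>\<^bsub>M\<^esub> B" "B \<sqsubseteq>\<^bsub>M\<^esub> A" and c: "A \<in> carrier M" "B \<in> carrier M"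
  obtain f where f: "f \<in> S" "A = germ F f" using c(1) by (rule carrier_germsE)
  obtain g where g: "g \<in> S" "B = germ F g" using c(2) by (rule carrier_germsE)
  have "\<forall>\<^sub>F j in F. f j \<sqsubseteq> g j" "\<forall>\<^sub>F j in F. g j \<sqsubseteq> f j"
    using le f g by (simp_all add: germ_le_iff)
  then have "\<forall>\<^sub>F j in F. f j = g j"
    by eventually_elim (use f g in \<open>auto intro: le_antisym representative_closed\<close>)
  then show "A = B" using f g by (simp add: germ_eq_iff)
next
  fix A B C
  assume "A \<sqsubseteq>\<^bsub>M\<^esub> B" "B \<sqsubseteq>\<^bsub>M\<^esub> C" "A \<in> carrier M" "B \<in> carrier M" "C \<in> carrier M"
  then obtain f g h where S: "f \<in> S" "g \<in> S" "h \<in> S"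
    and le: "\<forall>\<^sub>F j in F. f j \<sqsubseteq> g j" "\<forall>\<^sub>F j in F. g j \<sqsubseteq> h j" and eq: "A = germ F f" "C = germ F h"
    by (auto simp: carrier_germs germ_le_iff)
  from le have "\<forall>\<^sub>F j in F. f j \<sqsubseteq> h j"
    by (eventually_elim, use S in \<open>blast intro: le_trans representative_closed\<close>)
  then show "A \<sqsubseteq>\<^bsub>M\<^esub> C"
    by (simp add: eq germ_le_iff)
next
  fix A B C
  assume "A \<sqsubseteq>\<^bsub>M\<^esub> C" "B \<sqsubseteq>\<^bsub>M\<^esub> C" "A \<in> carrier M" "B \<in> carrier M" "C \<in> carrier M"
  then obtain f g h where S: "f \<in> S" "g \<in> S" "h \<in> S"
    and le: "\<forall>\<^sub>F j in F. f j \<sqsubseteq> h j" "\<forall>\<^sub>F j in F. g j \<sqsubseteq> h j"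
    and eq: "A = germ F f" "B = germ F g" "C = germ F h"
    by (auto simp: carrier_germs germ_le_iff)
  from le have "\<forall>\<^sub>F j in F. f j \<squnion> g j \<sqsubseteq> h j"
    by (eventually_elim, use S in \<open>blast intro: join_le representative_closed\<close>)
  then show "germ_lift F (join L) A B \<sqsubseteq>\<^bsub>M\<^esub> C"
    by (simp add: eq germ_lift_germ germ_le_iff)
next
  fix A B C
  assume "C \<sqsubseteq>\<^bsub>M\<^esub> A" "C \<sqsubseteq>\<^bsub>M\<^esub> B" "A \<in> carrier M" "B \<in> carrier M" "C \<in> carrier M"
  then obtain f g h where S: "f \<in> S" "g \<in> S" "h \<in> S"
    and le: "\<forall>\<^sub>F j in F. h j \<sqsubseteq> f j" "\<forall>\<^sub>F j in F. h j \<sqsubseteq> g j"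
    and eq: "A = germ F f" "B = germ F g" "C = germ F h"
    by (auto simp: carrier_germs germ_le_iff)
  from le have "\<forall>\<^sub>F j in F. h j \<sqsubseteq> f j \<sqinter> g j"
    by (eventually_elim, use S in \<open>blast intro: meet_le representative_closed\<close>)
  then show "C \<sqsubseteq>\<^bsub>M\<^esub> germ_lift F (meet L) A B"
    by (simp add: eq germ_lift_germ germ_le_iff)
qed (auto simp: carrier_germs germ_le_iff germ_lift_germ join_representable meet_representable
       intro!: always_eventually join_left join_right meet_left meet_right representative_closed)

lemma lattice_germs: "lattice M"
  by (rule lattice_operations.is_lattice[OF germs_operations])

lemma join_germs: "\<lbrakk>f \<in> S; g \<in> S\<rbrakk> \<Longrightarrow> germ F f \<squnion>\<^bsub>M\<^esub> germ F g = germ F (\<lambda>j. f j \<squnion> g j)"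
  by (simp add: lattice_operations.join_eq_J[OF germs_operations] carrier_germs germ_lift_germ)

lemma meet_germs: "\<lbrakk>f \<in> S; g \<in> S\<rbrakk> \<Longrightarrow> germ F f \<sqinter>\<^bsub>M\<^esub> germ F g = germ F (\<lambda>j. f j \<sqinter> g j)"
  by (simp add: lattice_operations.meet_eq_K[OF germs_operations] carrier_germs germ_lift_germ)

lemma eval_term_germs:
  assumes r: "\<And>n. r n \<in> S" and v: "\<And>n. v n = germ F (r n)"
  shows "eval_term M v t \<in> carrier M \<and>
    eval_term M v t = germ F (\<lambda>j. eval_term L (\<lambda>n. r n j) t)"
proof -
  interpret ops: lattice_operations M "germ_lift F (join L)" "germ_lift F (meet L)"
    by (rule germs_operations)
  show ?thesis
  proof (induction t)
    case (LJoin s t)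
    then have IH: "eval_term M v s \<in> carrier M" "eval_term M v t \<in> carrier M" by auto
    have "eval_term M v (LJoin s t) = germ_lift F (join L) (eval_term M v s) (eval_term M v t)"
      using IH by (simp add: ops.join_eq_J)
    then show ?case
      using ops.J_closed[OF IH] LJoin by (simp only: germ_lift_germ eval_term.simps)
  next
    case (LMeet s t)
    then have IH: "eval_term M v s \<in> carrier M" "eval_term M v t \<in> carrier M" by auto
    have "eval_term M v (LMeet s t) = germ_lift F (meet L) (eval_term M v s) (eval_term M v t)"
      using IH by (simp add: ops.meet_eq_K)
    then show ?case
      using ops.K_closed[OF IH] LMeet by (simp only: germ_lift_germ eval_term.simps)
  qed (simp add: carrier_germs r v)
qed

text \<open>The premises hold on a set of the filter each, hence, being finitely many, on a common one.
  There \<open>L\<close> yields the conclusion index by index. The representatives must take values in the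
  carrier at every index, because a valuation involves infinitely many variables at once.\<close>

lemma satisfies_germs:
  assumes "satisfies L q"
  shows "satisfies M q"
proof (cases q)
  case (Horn ps e)
  have "holds_eq M v e" if v: "range v \<subseteq> carrier M" and ps: "\<forall>p\<in>set ps. holds_eq M v p" for v
  proof -
    have "\<exists>r. \<forall>n. r n \<in> S \<and> v n = germ F (r n)"
      using v by (intro choice) (auto simp: carrier_germs image_subset_iff image_iff Bex_def)
    then obtain r where r: "\<And>n. r n \<in> S" "\<And>n. v n = germ F (r n)" by blast
    have holds: "holds_eq M v p \<longleftrightarrow> (\<forall>\<^sub>F j in F. holds_eq L (\<lambda>n. r n j) p)" for p
      by (simp add: holds_eq_def eval_term_germs[OF r] germ_eq_iff)
    have "\<forall>\<^sub>F j in F. \<forall>p\<in>set ps. holds_eq L (\<lambda>n. r n j) p"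
      using ps by (simp add: eventually_ball_finite holds)
    then have "\<forall>\<^sub>F j in F. holds_eq L (\<lambda>n. r n j) e"
    proof (rule eventually_mono)
      fix j assume "\<forall>p\<in>set ps. holds_eq L (\<lambda>n. r n j) p"
      then show "holds_eq L (\<lambda>n. r n j) e"
        using assms representative_closed[OF r(1)] by (simp add: Horn image_subset_iff)
    qed
    then show ?thesis by (simp add: holds)
  qed
  then show ?thesis by (simp add: Horn)
qed

lemma quasivariety_germs: "L \<in> quasivariety \<Sigma> \<Longrightarrow> M \<in> quasivariety \<Sigma>"
  by (auto simp: quasivariety_def lattice_germs satisfies_germs)

lemma modular_germs:
  assumes "modular_lattice L"
  shows "modular_lattice M"
proof -
  interpret modular_lattice L by fact
  interpret ops: lattice_operations M "germ_lift F (join L)" "germ_lift F (meet L)"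
    by (rule germs_operations)
  interpret M: lattice M by (rule lattice_germs)
  show ?thesis
  proof
    fix A B C assume c: "A \<in> carrier M" "B \<in> carrier M" "C \<in> carrier M" and le: "C \<sqsubseteq>\<^bsub>M\<^esub> A"
    obtain f where f: "f \<in> S" "A = germ F f" using c(1) by (rule carrier_germsE)
    obtain g where g: "g \<in> S" "B = germ F g" using c(2) by (rule carrier_germsE)
    obtain h where h: "h \<in> S" "C = germ F h" using c(3) by (rule carrier_germsE)
    have "\<forall>\<^sub>F j in F. h j \<sqsubseteq> f j" using le f h by (simp add: germ_le_iff)
    then have "\<forall>\<^sub>F j in F. f j \<sqinter> (g j \<squnion> h j) = (f j \<sqinter> g j) \<squnion> h j"
      by eventually_elim (use f g h in \<open>auto intro: modular_law representative_closed\<close>)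
    then have "germ_lift F (meet L) A (germ_lift F (join L) B C)
       = germ_lift F (join L) (germ_lift F (meet L) A B) C"
      using f g h by (simp add: germ_lift_germ germ_eq_iff)
    then show "A \<sqinter>\<^bsub>M\<^esub> (B \<squnion>\<^bsub>M\<^esub> C) = (A \<sqinter>\<^bsub>M\<^esub> B) \<squnion>\<^bsub>M\<^esub> C"
      using c by (simp add: ops.join_eq_J ops.meet_eq_K ops.J_closed ops.K_closed)
  qed
qed

end

section \<open>Germs along a Banaschewski trace\<close>

locale banaschewski_lattice = sectionally_complemented_lattice L + modular_lattice L
  for L :: "('a, 'b) gorder_scheme" (structure) +
  fixes \<Lambda> :: "('i, 'c) gorder_scheme" and a :: "'i \<Rightarrow> 'i \<Rightarrow> 'a"
  assumes trace: "banaschewski_trace L \<Lambda> a"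
begin

sublocale \<Lambda>: partial_order \<Lambda>
  using trace by (simp add: banaschewski_trace_def)

sublocale \<Lambda>: weak_partial_order_bottom \<Lambda>
  using trace by (simp add: banaschewski_trace_def)

abbreviation bot_index (\<open>\<o>\<close>) where "\<o> \<equiv> \<bottom>\<^bsub>\<Lambda>\<^esub>"

lemma trace_closed: "\<lbrakk>i \<in> carrier \<Lambda>; j \<in> carrier \<Lambda>; i \<sqsubseteq>\<^bsub>\<Lambda>\<^esub> j\<rbrakk> \<Longrightarrow> a i j \<in> carrier L"
  using trace by (simp add: banaschewski_trace_def)

lemma trace_sum:
  assumes "i \<in> carrier \<Lambda>" "j \<in> carrier \<Lambda>" "k \<in> carrier \<Lambda>" "i \<sqsubseteq>\<^bsub>\<Lambda>\<^esub> j" "j \<sqsubseteq>\<^bsub>\<Lambda>\<^esub> k"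
  shows "a i j \<sqinter> a j k = \<bottom>" "a i j \<squnion> a j k = a i k"
  using trace assms by (auto simp: banaschewski_trace_def oplus_eq_def)

lemma trace_cofinal: "x \<in> carrier L \<Longrightarrow> \<exists>i\<in>carrier \<Lambda>. x \<sqsubseteq> a \<o> i"
  using trace by (simp add: banaschewski_trace_def)

lemma index_directed:
  "\<lbrakk>i \<in> carrier \<Lambda>; j \<in> carrier \<Lambda>\<rbrakk> \<Longrightarrow> \<exists>k\<in>carrier \<Lambda>. i \<sqsubseteq>\<^bsub>\<Lambda>\<^esub> k \<and> j \<sqsubseteq>\<^bsub>\<Lambda>\<^esub> k"
  using trace by (simp add: banaschewski_trace_def upward_directed_def)

definition tails :: "'i filter" where
  "tails = (INF i\<in>carrier \<Lambda>. principal {j \<in> carrier \<Lambda>. i \<sqsubseteq>\<^bsub>\<Lambda>\<^esub> j})"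

lemma eventually_tails:
  "eventually P tails \<longleftrightarrow> (\<exists>i\<in>carrier \<Lambda>. \<forall>j\<in>carrier \<Lambda>. i \<sqsubseteq>\<^bsub>\<Lambda>\<^esub> j \<longrightarrow> P j)"
proof -
  have "\<exists>k\<in>carrier \<Lambda>. principal {j \<in> carrier \<Lambda>. k \<sqsubseteq>\<^bsub>\<Lambda>\<^esub> j} \<le>
      inf (principal {n \<in> carrier \<Lambda>. i \<sqsubseteq>\<^bsub>\<Lambda>\<^esub> n}) (principal {n \<in> carrier \<Lambda>. j \<sqsubseteq>\<^bsub>\<Lambda>\<^esub> n})"
    if ij: "i \<in> carrier \<Lambda>" "j \<in> carrier \<Lambda>" for i j
  proof -
    obtain k where "k \<in> carrier \<Lambda>" "i \<sqsubseteq>\<^bsub>\<Lambda>\<^esub> k" "j \<sqsubseteq>\<^bsub>\<Lambda>\<^esub> k"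
      using index_directed[OF ij] by blast
    then show ?thesis
      using ij by (intro bexI[of _ k]) (auto intro: \<Lambda>.le_trans)
  qed
  then show ?thesis
    unfolding tails_def by (subst eventually_INF_base) (auto simp: eventually_principal)
qed

lemma eventually_tailsI:
  "\<lbrakk>i \<in> carrier \<Lambda>; \<And>j. j \<in> carrier \<Lambda> \<Longrightarrow> i \<sqsubseteq>\<^bsub>\<Lambda>\<^esub> j \<Longrightarrow> P j\<rbrakk> \<Longrightarrow> eventually P tails"
  by (auto simp: eventually_tails)

lemma tails_nontrivial: "tails \<noteq> bot"
  unfolding trivial_limit_def eventually_tails using \<Lambda>.le_refl by blast

text \<open>Germs only see the indices above \<open>i\<close>; elsewhere \<open>x\<close> serves as a default value, so that all
  values lie in the carrier.\<close>

definition shift :: "'i \<Rightarrow> 'a \<Rightarrow> 'i \<Rightarrow> 'a" where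
  "shift i x j = (if j \<in> carrier \<Lambda> \<and> i \<sqsubseteq>\<^bsub>\<Lambda>\<^esub> j then x \<squnion> a i j else x)"

lemma shift_closed: "\<lbrakk>x \<in> carrier L; i \<in> carrier \<Lambda>\<rbrakk> \<Longrightarrow> shift i x j \<in> carrier L"
  by (simp add: shift_def trace_closed)

definition generators :: "('i \<Rightarrow> 'a) set" where
  "generators = {\<lambda>_. x | x. x \<in> carrier L} \<union> {shift i x | i x. i \<in> carrier \<Lambda> \<and> x \<in> carrier L}"

abbreviation const_germ :: "'a \<Rightarrow> ('i \<Rightarrow> 'a) set" where
  "const_germ x \<equiv> germ tails (\<lambda>_. x)"

abbreviation shift_germ :: "'i \<Rightarrow> 'a \<Rightarrow> ('i \<Rightarrow> 'a) set" where
  "shift_germ i x \<equiv> germ tails (shift i x)"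

definition section_below :: "'i \<Rightarrow> 'a set" where
  "section_below k = {x \<in> carrier L. x \<sqsubseteq> a \<o> k}"

lemma join_assoc: "\<lbrakk>x \<in> carrier L; y \<in> carrier L; z \<in> carrier L\<rbrakk> \<Longrightarrow> (x \<squnion> y) \<squnion> z = x \<squnion> (y \<squnion> z)"
  using weak_join_assoc eq_is_equal by simp

lemma trace_mono:
  assumes "i \<in> carrier \<Lambda>" "k \<in> carrier \<Lambda>" "i \<sqsubseteq>\<^bsub>\<Lambda>\<^esub> k"
  shows "a \<o> i \<sqsubseteq> a \<o> k"
  using assms trace_sum(2)[of \<o> i k] trace_closed[of \<o> i] trace_closed[of i k]
    join_left[of "a \<o> i" "a i k"] by simp

text \<open>Here the join half of the trace identity enters: \<open>x \<squnion> a i j = (x \<squnion> a i k) \<squnion> a k j\<close>.\<close>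

lemma shift_germ_raise:
  assumes "i \<in> carrier \<Lambda>" "k \<in> carrier \<Lambda>" "i \<sqsubseteq>\<^bsub>\<Lambda>\<^esub> k" "x \<in> carrier L"
  shows "shift_germ i x = shift_germ k (x \<squnion> a i k)"
  unfolding germ_eq_iff
proof (rule eventually_tailsI[OF assms(2)])
  fix j assume j: "j \<in> carrier \<Lambda>" "k \<sqsubseteq>\<^bsub>\<Lambda>\<^esub> j"
  then have "i \<sqsubseteq>\<^bsub>\<Lambda>\<^esub> j" using assms \<Lambda>.le_trans by blast
  then show "shift i x j = shift k (x \<squnion> a i k) j"
    using assms j by (simp add: shift_def join_assoc trace_closed trace_sum)
qed

lemma section_eventually:
  assumes "x \<in> carrier L"
  shows "\<forall>\<^sub>F k in tails. x \<in> section_below k"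
proof -
  obtain i where i: "i \<in> carrier \<Lambda>" "x \<sqsubseteq> a \<o> i" using trace_cofinal assms by blast
  then show ?thesis
    using assms by (intro eventually_tailsI[OF i(1)])
      (auto simp: section_below_def intro: le_trans trace_mono trace_closed)
qed

text \<open>Constants are below \<open>a 0 k\<close> for large \<open>k\<close> by cofinality. A shifted element is first rebased
  from \<open>i\<close> to \<open>k\<close>; its new parameter \<open>x \<squnion> a i k\<close> is still below \<open>a 0 k = a 0 i \<squnion> a i k\<close>.
  Holding for all large \<open>k\<close>, this gives a common index for several germs.\<close>

lemma normal_form:
  assumes "f \<in> generators"
  shows "\<forall>\<^sub>F k in tails. \<exists>x\<in>section_below k. germ tails f = const_germ x \<or> germ tails f = shift_germ k x"
  using assms unfolding generators_def
proof (elim UnE CollectE exE conjE)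
  fix x assume "f = (\<lambda>_. x)" "x \<in> carrier L"
  then show ?thesis using section_eventually[of x] by (auto elim: eventually_mono)
next
  fix i x assume f: "f = shift i x" "i \<in> carrier \<Lambda>" "x \<in> carrier L"
  obtain k0 where k0: "k0 \<in> carrier \<Lambda>" "x \<sqsubseteq> a \<o> k0" using trace_cofinal f by blast
  obtain k1 where k1: "k1 \<in> carrier \<Lambda>" "i \<sqsubseteq>\<^bsub>\<Lambda>\<^esub> k1" "k0 \<sqsubseteq>\<^bsub>\<Lambda>\<^esub> k1"
    using index_directed[OF f(2) k0(1)] by blast
  show ?thesis
  proof (rule eventually_tailsI[OF k1(1)])
    fix k assume k: "k \<in> carrier \<Lambda>" "k1 \<sqsubseteq>\<^bsub>\<Lambda>\<^esub> k"
    have ik: "i \<sqsubseteq>\<^bsub>\<Lambda>\<^esub> k" and k0k: "k0 \<sqsubseteq>\<^bsub>\<Lambda>\<^esub> k" using k k1 k0 f \<Lambda>.le_trans by blast+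
    have "x \<sqsubseteq> a \<o> k"
      using k0 f k k0k trace_mono[of k0 k] trace_closed[of \<o>] le_trans[of x "a \<o> k0" "a \<o> k"] by simp
    moreover have "a i k \<sqsubseteq> a \<o> k"
      using f k ik trace_sum(2)[of \<o> i k] join_right[of "a \<o> i" "a i k"] by (simp add: trace_closed)
    ultimately have "x \<squnion> a i k \<in> section_below k"
      using f k ik by (simp add: section_below_def join_le trace_closed)
    then show "\<exists>y\<in>section_below k. germ tails f = const_germ y \<or> germ tails f = shift_germ k y"
      using shift_germ_raise[OF f(2) k(1) ik f(3)] f(1) by blast
  qed
qed

lemma normal_form3:
  assumes "f \<in> generators" "g \<in> generators" "z \<in> carrier L"
  obtains k x y where "k \<in> carrier \<Lambda>" "x \<in> section_below k" "y \<in> section_below k" "z \<in> section_below k"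
    "germ tails f = const_germ x \<or> germ tails f = shift_germ k x"
    "germ tails g = const_germ y \<or> germ tails g = shift_germ k y"
proof -
  have "\<forall>\<^sub>F k in tails. k \<in> carrier \<Lambda>"
    by (rule eventually_tailsI[OF \<Lambda>.bottom_closed])
  from eventually_conj[OF this eventually_conj[OF normal_form[OF assms(1)]
      eventually_conj[OF normal_form[OF assms(2)] section_eventually[OF assms(3)]]]]
  obtain k where "k \<in> carrier \<Lambda>" "z \<in> section_below k"
    and "\<exists>x\<in>section_below k. germ tails f = const_germ x \<or> germ tails f = shift_germ k x"
    and "\<exists>y\<in>section_below k. germ tails g = const_germ y \<or> germ tails g = shift_germ k y"
    by (auto dest!: eventually_happens'[OF tails_nontrivial])
  then show ?thesis
    by (elim bexE) (rule that)
qed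

text \<open>By modularity \<open>b \<sqinter> (y \<squnion> e) = (b \<sqinter> e) \<squnion> y = y\<close>: inside the section below \<open>b\<close>, an element
  disjoint from \<open>b\<close> cannot be seen.\<close>

lemma section_meet:
  assumes "x \<in> carrier L" "y \<in> carrier L" "b \<in> carrier L" "e \<in> carrier L"
    and "x \<sqsubseteq> b" "y \<sqsubseteq> b" "b \<sqinter> e = \<bottom>"
  shows "x \<sqinter> (y \<squnion> e) = x \<sqinter> y"
proof -
  have "\<bottom> \<squnion> y = y"
    using le_iff_meet[of "\<bottom>" y] assms(2) by simp
  then have b: "b \<sqinter> (y \<squnion> e) = y"
    using modular_law[of b e y] assms by (simp add: join_comm[of L y])
  have c: "x \<sqinter> y \<in> carrier L" "y \<squnion> e \<in> carrier L" "x \<sqinter> (y \<squnion> e) \<in> carrier L"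
    using assms by simp_all
  have x: "x \<sqinter> (y \<squnion> e) \<sqsubseteq> x" and ye: "x \<sqinter> (y \<squnion> e) \<sqsubseteq> y \<squnion> e"
    using assms by (simp_all add: meet_left meet_right)
  have "x \<sqinter> (y \<squnion> e) \<sqsubseteq> b \<sqinter> (y \<squnion> e)"
    using le_trans[OF x assms(5)] ye assms c by (simp add: meet_le)
  then have le: "x \<sqinter> (y \<squnion> e) \<sqsubseteq> x \<sqinter> y"
    using x assms c by (simp add: b meet_le)
  have "x \<sqinter> y \<sqsubseteq> y \<squnion> e"
    using le_trans[OF meet_right[of x y] join_left[of y e]] assms by simp
  then have "x \<sqinter> y \<sqsubseteq> x \<sqinter> (y \<squnion> e)"
    using assms c by (simp add: meet_le meet_left)
  with le show ?thesis
    using c by (simp add: le_antisym)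
qed

text \<open>The isomorphism between the intervals from \<open>b \<sqinter> e\<close> to \<open>b\<close> and from \<open>e\<close> to \<open>b \<squnion> e\<close> in a
  modular lattice preserves meets.\<close>

lemma shift_meet:
  assumes "x \<in> carrier L" "y \<in> carrier L" "b \<in> carrier L" "e \<in> carrier L"
    and "x \<sqsubseteq> b" "y \<sqsubseteq> b" "b \<sqinter> e = \<bottom>"
  shows "(x \<squnion> e) \<sqinter> (y \<squnion> e) = (x \<sqinter> y) \<squnion> e"
proof -
  have "(x \<squnion> e) \<sqinter> (y \<squnion> e) = ((x \<squnion> e) \<sqinter> y) \<squnion> e"
    using assms modular_law[of "x \<squnion> e" y e] join_right[of x e] by simp
  also have "(x \<squnion> e) \<sqinter> y = x \<sqinter> y"
    using section_meet[of y x b e] assms meet_comm[of L "x \<squnion> e" y] meet_comm[of L x y] by simp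
  finally show ?thesis .
qed

lemma section_trace_disjoint:
  assumes "k \<in> carrier \<Lambda>" "j \<in> carrier \<Lambda>" "k \<sqsubseteq>\<^bsub>\<Lambda>\<^esub> j"
  shows "a \<o> k \<in> carrier L" "a k j \<in> carrier L" "a \<o> k \<sqinter> a k j = \<bottom>"
  using assms by (auto simp: trace_sum trace_closed)

context
  fixes k x y
  assumes k: "k \<in> carrier \<Lambda>" and x: "x \<in> section_below k" and y: "y \<in> section_below k"
begin

lemma pointwise_join:
  "germ tails (\<lambda>j. x \<squnion> shift k y j) = shift_germ k (x \<squnion> y)"
  "germ tails (\<lambda>j. shift k x j \<squnion> y) = shift_germ k (x \<squnion> y)"
  "germ tails (\<lambda>j. shift k x j \<squnion> shift k y j) = shift_germ k (x \<squnion> y)"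
proof -
  have c: "x \<in> carrier L" "y \<in> carrier L" using x y by (auto simp: section_below_def)
  have e: "x \<squnion> (y \<squnion> e) = (x \<squnion> y) \<squnion> e" "(x \<squnion> e) \<squnion> y = (x \<squnion> y) \<squnion> e"
    "(x \<squnion> e) \<squnion> (y \<squnion> e) = (x \<squnion> y) \<squnion> e" if "e \<in> carrier L" for e
  proof -
    show "x \<squnion> (y \<squnion> e) = (x \<squnion> y) \<squnion> e" using c that by (simp add: join_assoc)
    show *: "(x \<squnion> e) \<squnion> y = (x \<squnion> y) \<squnion> e"
      using c that join_comm[of L e y] by (simp add: join_assoc)
    have "(x \<squnion> e) \<squnion> (y \<squnion> e) = ((x \<squnion> e) \<squnion> y) \<squnion> e"
      using c that by (simp add: join_assoc)
    also have "\<dots> = (x \<squnion> y) \<squnion> (e \<squnion> e)" using c that by (simp add: * join_assoc)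
    also have "e \<squnion> e = e" using le_iff_meet[of e e] that by simp
    finally show "(x \<squnion> e) \<squnion> (y \<squnion> e) = (x \<squnion> y) \<squnion> e" .
  qed
  show "germ tails (\<lambda>j. x \<squnion> shift k y j) = shift_germ k (x \<squnion> y)"
    "germ tails (\<lambda>j. shift k x j \<squnion> y) = shift_germ k (x \<squnion> y)"
    "germ tails (\<lambda>j. shift k x j \<squnion> shift k y j) = shift_germ k (x \<squnion> y)"
    unfolding germ_eq_iff
    by (rule eventually_tailsI[OF k], simp only: shift_def e[OF trace_closed[OF k]] if_True simp_thms)+
qed

lemma pointwise_meet:
  "germ tails (\<lambda>j. x \<sqinter> shift k y j) = const_germ (x \<sqinter> y)"
  "germ tails (\<lambda>j. shift k x j \<sqinter> y) = const_germ (x \<sqinter> y)"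
  "germ tails (\<lambda>j. shift k x j \<sqinter> shift k y j) = shift_germ k (x \<sqinter> y)"
proof -
  have c: "x \<in> carrier L" "y \<in> carrier L" "x \<sqsubseteq> a \<o> k" "y \<sqsubseteq> a \<o> k"
    using x y by (auto simp: section_below_def)
  have e: "x \<sqinter> (y \<squnion> a k j) = x \<sqinter> y" "(x \<squnion> a k j) \<sqinter> y = x \<sqinter> y"
    "(x \<squnion> a k j) \<sqinter> (y \<squnion> a k j) = (x \<sqinter> y) \<squnion> a k j" if "j \<in> carrier \<Lambda>" "k \<sqsubseteq>\<^bsub>\<Lambda>\<^esub> j" for j
  proof -
    note d = section_trace_disjoint[OF k that]
    show "x \<sqinter> (y \<squnion> a k j) = x \<sqinter> y"
      by (rule section_meet[OF c(1,2) d(1,2) c(3,4) d(3)])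
    show "(x \<squnion> a k j) \<sqinter> y = x \<sqinter> y"
      using section_meet[OF c(2,1) d(1,2) c(4,3) d(3)] meet_comm[of L "x \<squnion> a k j" y] meet_comm[of L x y]
      by simp
    show "(x \<squnion> a k j) \<sqinter> (y \<squnion> a k j) = (x \<sqinter> y) \<squnion> a k j"
      by (rule shift_meet[OF c(1,2) d(1,2) c(3,4) d(3)])
  qed
  show "germ tails (\<lambda>j. x \<sqinter> shift k y j) = const_germ (x \<sqinter> y)"
    "germ tails (\<lambda>j. shift k x j \<sqinter> y) = const_germ (x \<sqinter> y)"
    "germ tails (\<lambda>j. shift k x j \<sqinter> shift k y j) = shift_germ k (x \<sqinter> y)"
    unfolding germ_eq_iff
    by (rule eventually_tailsI[OF k], simp only: shift_def e if_True simp_thms)+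
qed

end

text \<open>All closure properties follow by bringing both arguments over a common index, where the
  pointwise formulas apply.\<close>

sublocale reduced_power_sublattice L tails generators
proof
  show "f j \<in> carrier L" if "f \<in> generators" for f j
    using that by (auto simp: generators_def shift_closed)
  have const: "const_germ x \<in> germ tails ` generators" if "x \<in> carrier L" for x
    using that by (auto simp: generators_def)
  have shifted: "shift_germ k x \<in> germ tails ` generators" if "k \<in> carrier \<Lambda>" "x \<in> carrier L" for k x
    using that by (auto simp: generators_def)
  fix f g assume "f \<in> generators" "g \<in> generators"
  then obtain k x y where k: "k \<in> carrier \<Lambda>" and xy: "x \<in> section_below k" "y \<in> section_below k"
    and f: "germ tails f = const_germ x \<or> germ tails f = shift_germ k x"
    and g: "germ tails g = const_germ y \<or> germ tails g = shift_germ k y"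
    by (rule normal_form3[OF _ _ bottom_closed])
  have c: "x \<in> carrier L" "y \<in> carrier L" using xy by (auto simp: section_below_def)
  show "germ tails (\<lambda>j. f j \<squnion> g j) \<in> germ tails ` generators"
    unfolding germ_lift_germ[symmetric]
    using f g k c by (elim disjE)
      (simp_all add: germ_lift_germ pointwise_join[OF k xy] const shifted)
  show "germ tails (\<lambda>j. f j \<sqinter> g j) \<in> germ tails ` generators"
    unfolding germ_lift_germ[symmetric]
    using f g k c by (elim disjE)
      (simp_all add: germ_lift_germ pointwise_meet[OF k xy] const shifted)
qed

section \<open>The complemented lattice and its ideal of constants\<close>

sublocale M: lattice M
  by (rule lattice_germs)

lemma const_generator: "x \<in> carrier L \<Longrightarrow> (\<lambda>_. x) \<in> generators"
  by (auto simp: generators_def)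

lemma shift_generator: "\<lbrakk>k \<in> carrier \<Lambda>; x \<in> carrier L\<rbrakk> \<Longrightarrow> shift k x \<in> generators"
  by (auto simp: generators_def)

lemma const_germ_closed: "x \<in> carrier L \<Longrightarrow> const_germ x \<in> carrier M"
  by (simp add: carrier_germs const_generator)

lemma shift_germ_closed: "\<lbrakk>k \<in> carrier \<Lambda>; x \<in> carrier L\<rbrakk> \<Longrightarrow> shift_germ k x \<in> carrier M"
  by (simp add: carrier_germs shift_generator)

lemma section_closed: "x \<in> section_below k \<Longrightarrow> x \<in> carrier L"
  by (simp add: section_below_def)

lemma const_germ_ops:
  assumes "x \<in> carrier L" "y \<in> carrier L"
  shows "const_germ x \<squnion>\<^bsub>M\<^esub> const_germ y = const_germ (x \<squnion> y)"
    "const_germ x \<sqinter>\<^bsub>M\<^esub> const_germ y = const_germ (x \<sqinter> y)"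
  using assms by (simp_all add: join_germs meet_germs const_generator)

lemma shift_germ_ops:
  assumes k: "k \<in> carrier \<Lambda>" and xy: "x \<in> section_below k" "y \<in> section_below k"
  shows "const_germ x \<squnion>\<^bsub>M\<^esub> shift_germ k y = shift_germ k (x \<squnion> y)"
    "shift_germ k x \<squnion>\<^bsub>M\<^esub> const_germ y = shift_germ k (x \<squnion> y)"
    "shift_germ k x \<squnion>\<^bsub>M\<^esub> shift_germ k y = shift_germ k (x \<squnion> y)"
    "const_germ x \<sqinter>\<^bsub>M\<^esub> shift_germ k y = const_germ (x \<sqinter> y)"
    "shift_germ k x \<sqinter>\<^bsub>M\<^esub> const_germ y = const_germ (x \<sqinter> y)"
    "shift_germ k x \<sqinter>\<^bsub>M\<^esub> shift_germ k y = shift_germ k (x \<sqinter> y)"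
  using xy[THEN section_closed] k
  by (simp_all add: join_germs meet_germs const_generator shift_generator
      pointwise_join[OF k xy] pointwise_meet[OF k xy])

lemma const_germ_le_iff: "const_germ x \<sqsubseteq>\<^bsub>M\<^esub> const_germ y \<longleftrightarrow> x \<sqsubseteq> y"
  by (simp add: germ_le_iff tails_nontrivial)

lemma const_germ_eq_iff: "const_germ x = const_germ y \<longleftrightarrow> x = y"
  by (simp add: germ_eq_iff tails_nontrivial)

lemma const_germ_le_shift_iff:
  assumes k: "k \<in> carrier \<Lambda>" and xy: "x \<in> section_below k" "y \<in> section_below k"
  shows "const_germ x \<sqsubseteq>\<^bsub>M\<^esub> shift_germ k y \<longleftrightarrow> x \<sqsubseteq> y"
  using M.le_iff_join[of "const_germ x" "shift_germ k y"] le_iff_join[of x y]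
    section_closed[OF xy(1)] section_closed[OF xy(2)] k
  by (simp add: shift_germ_ops[OF k xy] const_germ_closed shift_germ_closed const_germ_eq_iff)

lemma germ_normal_form:
  assumes "A \<in> carrier M" "B \<in> carrier M" "z \<in> carrier L"
  obtains k x y where "k \<in> carrier \<Lambda>" "x \<in> section_below k" "y \<in> section_below k" "z \<in> section_below k"
    "A = const_germ x \<or> A = shift_germ k x" "B = const_germ y \<or> B = shift_germ k y"
proof -
  obtain f where f: "f \<in> generators" "A = germ tails f" using assms(1) by (rule carrier_germsE)
  obtain g where g: "g \<in> generators" "B = germ tails g" using assms(2) by (rule carrier_germsE)
  show ?thesis
    by (rule normal_form3[OF f(1) g(1) assms(3)]) (rule that; simp add: f g)
qed

lemma lattice_embedding_const: "lattice_embedding L M const_germ"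
  by (auto simp: lattice_embedding_def join_pres_def meet_pres_def inj_on_def
      const_germ_closed const_germ_eq_iff const_germ_ops lattice_axioms lattice_germs)

text \<open>A complement of a constant is a shifted germ and vice versa. The unit is
  \<open>j \<mapsto> a 0 j\<close>, that is, the germ of \<open>\<bottom>\<close> shifted at the least index; rebased to \<open>k\<close> its parameter
  is \<open>a 0 k\<close>, the top of the section in which the complement was taken.\<close>

lemma germ_complement:
  assumes "A \<in> carrier M"
  shows "\<exists>B\<in>carrier M. A \<sqinter>\<^bsub>M\<^esub> B = const_germ \<bottom> \<and> A \<squnion>\<^bsub>M\<^esub> B = shift_germ \<o> \<bottom>"
proof -
  obtain k x where k: "k \<in> carrier \<Lambda>" and x: "x \<in> section_below k"
    and A: "A = const_germ x \<or> A = shift_germ k x"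
    by (rule germ_normal_form[OF assms assms bottom_closed])
  have c: "x \<in> carrier L" "a \<o> k \<in> carrier L"
    using section_closed[OF x] k by (auto simp: trace_closed)
  obtain y where y: "y \<in> carrier L" "x \<sqinter> y = \<bottom>" "x \<squnion> y = a \<o> k"
    using section_complement_exists[OF c] x by (auto simp: section_below_def oplus_eq_def)
  have yk: "y \<in> section_below k"
    using y join_right[OF c(1) y(1)] by (simp add: section_below_def)
  have top: "shift_germ k (a \<o> k) = shift_germ \<o> \<bottom>"
    using shift_germ_raise[OF \<Lambda>.bottom_closed k \<Lambda>.bottom_lower[OF k] bottom_closed]
      le_iff_meet[OF bottom_closed c(2)] c by simp
  from A show ?thesis
  proof
    assume "A = const_germ x"
    then show ?thesis
      using y k by (intro bexI[of _ "shift_germ k y"])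
        (simp_all add: shift_germ_ops[OF k x yk] top shift_germ_closed)
  next
    assume "A = shift_germ k x"
    then show ?thesis
      using y k by (intro bexI[of _ "const_germ y"])
        (simp_all add: shift_germ_ops[OF k x yk] top const_germ_closed)
  qed
qed

lemma complemented_germs: "complemented_lattice M"
proof
  have bot: "const_germ \<bottom> \<in> carrier M" and top: "shift_germ \<o> \<bottom> \<in> carrier M"
    by (auto intro: const_germ_closed shift_germ_closed)
  have below: "const_germ \<bottom> \<sqsubseteq>\<^bsub>M\<^esub> A" "A \<sqsubseteq>\<^bsub>M\<^esub> shift_germ \<o> \<bottom>" if A: "A \<in> carrier M" for A
    using germ_complement[OF A] M.meet_left[OF A] M.join_left[OF A] by metis+
  show least: "\<exists>x. least M x (carrier M)"
    using bot below by (auto simp: least_def)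
  show greatest: "\<exists>x. greatest M x (carrier M)"
    using top below by (auto simp: greatest_def)
  interpret M: bounded_lattice M
    by unfold_locales (fact least, fact greatest)
  have "const_germ \<bottom> = \<bottom>\<^bsub>M\<^esub>" "shift_germ \<o> \<bottom> = \<top>\<^bsub>M\<^esub>"
    using M.bottom_eq[OF bot] M.top_eq[OF top] below by auto
  then show "\<exists>y\<in>carrier M. A \<sqinter>\<^bsub>M\<^esub> y = \<bottom>\<^bsub>M\<^esub> \<and> A \<squnion>\<^bsub>M\<^esub> y = \<top>\<^bsub>M\<^esub>" if "A \<in> carrier M" for A
    using germ_complement[OF that] by simp
qed

text \<open>An element below a constant \<open>z\<close> equals its meet with \<open>z\<close>, and the meet of anything with a
  constant is constant. This also covers a shifted germ that happens to equal a constant one, as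
  occurs when \<open>L\<close> has a unit.\<close>

lemma const_germs_ideal: "lattice_ideal M (const_germ ` carrier L)"
proof (rule M.lattice_idealI)
  show "A \<in> const_germ ` carrier L"
    if B: "B \<in> const_germ ` carrier L" and A: "A \<in> carrier M" "A \<sqsubseteq>\<^bsub>M\<^esub> B" for A B
  proof -
    obtain z where z: "z \<in> carrier L" "B = const_germ z" using B by auto
    obtain k x where k: "k \<in> carrier \<Lambda>" "x \<in> section_below k" "z \<in> section_below k"
      and x: "A = const_germ x \<or> A = shift_germ k x"
      by (rule germ_normal_form[OF A(1) A(1) z(1)])
    have "A = A \<sqinter>\<^bsub>M\<^esub> B"
      using M.le_iff_join[of A B] A z const_germ_closed by simp
    also have "\<dots> = const_germ (x \<sqinter> z)"
      using x z k section_closed[OF k(2)] by (auto simp: shift_germ_ops const_germ_ops)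
    finally show ?thesis
      using z section_closed[OF k(2)] by simp
  qed
qed (auto simp: const_germ_closed const_germ_ops)

lemma const_germs_neutral: "neutral_ideal M (const_germ ` carrier L)"
proof (rule M.neutral_idealI[OF const_germs_ideal])
  fix X U V
  assume X: "X \<in> const_germ ` carrier L" and U: "U \<in> carrier M" and V: "V \<in> carrier M"
    and le: "X \<sqsubseteq>\<^bsub>M\<^esub> U \<squnion>\<^bsub>M\<^esub> V"
  obtain z where z: "z \<in> carrier L" "X = const_germ z" using X by auto
  obtain k x y where k: "k \<in> carrier \<Lambda>" and s: "x \<in> section_below k" "y \<in> section_below k" "z \<in> section_below k"
    and x: "U = const_germ x \<or> U = shift_germ k x" and y: "V = const_germ y \<or> V = shift_germ k y"
    by (rule germ_normal_form[OF U V z(1)])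
  have c: "x \<in> carrier L" "y \<in> carrier L" using s by (auto intro: section_closed)
  have xy: "x \<squnion> y \<in> section_below k"
    using s k by (auto simp: section_below_def trace_closed intro: join_le)
  have "U \<squnion>\<^bsub>M\<^esub> V = const_germ (x \<squnion> y) \<or> U \<squnion>\<^bsub>M\<^esub> V = shift_germ k (x \<squnion> y)"
    using x y by (elim disjE) (simp_all add: const_germ_ops c shift_germ_ops[OF k s(1,2)])
  then have "z \<sqsubseteq> x \<squnion> y"
    using le z(2) by (auto simp: const_germ_le_iff const_germ_le_shift_iff[OF k s(3) xy])
  moreover have "const_germ x \<sqsubseteq>\<^bsub>M\<^esub> U" "const_germ y \<sqsubseteq>\<^bsub>M\<^esub> V"
    using x y by (auto simp: const_germ_le_iff const_germ_le_shift_iff k s c)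
  ultimately show "\<exists>Y\<in>const_germ ` carrier L. \<exists>Z\<in>const_germ ` carrier L.
      Y \<sqsubseteq>\<^bsub>M\<^esub> U \<and> Z \<sqsubseteq>\<^bsub>M\<^esub> V \<and> X \<sqsubseteq>\<^bsub>M\<^esub> Y \<squnion>\<^bsub>M\<^esub> Z"
    using c z(2) by (intro bexI[of _ "const_germ x"] bexI[of _ "const_germ y"])
      (simp_all add: const_germ_ops const_germ_le_iff)
next
  fix U V
  assume U: "U \<in> carrier M" and V: "V \<in> carrier M" and UV: "U \<sqinter>\<^bsub>M\<^esub> V \<in> const_germ ` carrier L"
  obtain k x y where k: "k \<in> carrier \<Lambda>" and s: "x \<in> section_below k" "y \<in> section_below k"
    and x: "U = const_germ x \<or> U = shift_germ k x" and y: "V = const_germ y \<or> V = shift_germ k y"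
    by (rule germ_normal_form[OF U V bottom_closed])
  have c: "x \<in> carrier L" "y \<in> carrier L" using s by (auto intro: section_closed)
  show "U \<in> const_germ ` carrier L \<or> V \<in> const_germ ` carrier L"
  proof (rule disjCI)
    assume "V \<notin> const_germ ` carrier L"
    then have V': "V = shift_germ k y" using y c by auto
    show "U \<in> const_germ ` carrier L"
    proof (cases "U = const_germ x")
      case True
      then show ?thesis using c by simp
    next
      case False
      then have U': "U = shift_germ k x" using x by simp
      have m: "x \<sqinter> y \<in> section_below k"
        using s k c le_trans[OF meet_left[OF c] _ _ c(1) trace_closed[OF \<Lambda>.bottom_closed k \<Lambda>.bottom_lower[OF k]]]
        by (auto simp: section_below_def)
      have "x \<squnion> (x \<sqinter> y) = x"
        using le_iff_meet[of "x \<sqinter> y" x] c by (simp add: meet_left join_comm)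
      \<comment> \<open>The shift at \<open>k\<close> is already present in \<open>U \<sqinter> V\<close>, so \<open>U\<close> is recovered from it by
        joining a constant, and this stays in the ideal.\<close>
      then have "U = const_germ x \<squnion>\<^bsub>M\<^esub> (U \<sqinter>\<^bsub>M\<^esub> V)"
        by (simp add: U' V' shift_germ_ops[OF k s] shift_germ_ops[OF k s(1) m])
      then show ?thesis
        using M.ideal_join_mem[OF const_germs_ideal _ UV, of "const_germ x"] c by simp
    qed
  qed
next
  fix U W
  assume U: "U \<in> carrier M" and W: "W \<in> carrier M" and nW: "W \<notin> const_germ ` carrier L"
  obtain k x y where k: "k \<in> carrier \<Lambda>" and s: "x \<in> section_below k" "y \<in> section_below k"
    and x: "U = const_germ x \<or> U = shift_germ k x" and y: "W = const_germ y \<or> W = shift_germ k y"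
    by (rule germ_normal_form[OF U W bottom_closed])
  have c: "x \<in> carrier L" "y \<in> carrier L" using s by (auto intro: section_closed)
  have W': "W = shift_germ k y" using y nW c by auto
  have "U \<squnion>\<^bsub>M\<^esub> W = const_germ x \<squnion>\<^bsub>M\<^esub> W"
    using x by (auto simp: W' shift_germ_ops[OF k s])
  then have "U \<sqsubseteq>\<^bsub>M\<^esub> const_germ x \<squnion>\<^bsub>M\<^esub> W"
    using M.join_left[OF U W] by simp
  moreover have "const_germ x \<sqsubseteq>\<^bsub>M\<^esub> U"
    using x by (auto simp: const_germ_le_iff const_germ_le_shift_iff k s c)
  ultimately show "\<exists>Y\<in>const_germ ` carrier L. Y \<sqsubseteq>\<^bsub>M\<^esub> U \<and> U \<sqsubseteq>\<^bsub>M\<^esub> Y \<squnion>\<^bsub>M\<^esub> W"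
    using c by blast
qed

end

theorem theorem5p3:
  fixes L :: "('a, 'b) gorder_scheme"
    and \<Lambda> :: "('i, 'c) gorder_scheme"
    and a :: "'i \<Rightarrow> 'i \<Rightarrow> 'a"
  assumes "sectionally_complemented_lattice L"
    and "modular_lattice L"
    and "banaschewski_trace L \<Lambda> a"
  shows "\<exists>(M :: ('i \<Rightarrow> 'a) set gorder) (\<epsilon> :: 'a \<Rightarrow> ('i \<Rightarrow> 'a) set).
           complemented_lattice M \<and> modular_lattice M \<and>
           (\<forall>\<Sigma>. L \<in> quasivariety \<Sigma> \<longrightarrow> M \<in> quasivariety \<Sigma>) \<and>
           lattice_embedding L M \<epsilon> \<and>
           neutral_ideal M (\<epsilon> ` carrier L)"
proof -
  interpret banaschewski_lattice L \<Lambda> a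
    using assms by (simp add: banaschewski_lattice_def banaschewski_lattice_axioms_def)
  show ?thesis
    using complemented_germs modular_germs[OF assms(2)] quasivariety_germs
      lattice_embedding_const const_germs_neutral
    by blast
qed

end
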